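(* Let $q\ge1$ and $0\le r<q$ be integers, let $\omega=e^{2\pi i/q}$, and let $\eta_\ell:=\exp\left(\frac i2\operatorname{Arg}(\omega^\ell)\right)$ for $0\le\ell<q$. For every integer $m\ge0$, $$\sum_{\substack{n\ge0\\ n\equiv r\ (\mathrm{mod}\ q)}}\frac{\binom{2n}{n}}{4^n(2n+1)}t_n(\{2\}^m)=\frac1q\sum_{\ell=0}^{q-1}\omega^{-r\ell}\frac{(\arcsin\eta_\ell)^{2m+1}}{(2m+1)!\,\eta_\ell}.$$ For every integer $m\ge1$, $$\sum_{\substack{n\ge1\\ n\equiv r\ (\mathrm{mod}\ q)}}\frac{4^n}{n^2\binom{2n}{n}}\zeta_{n-1}(\{2\}^{m-1})=\frac1q\sum_{\ell=0}^{q-1}\omega^{-r\ell}\frac{2^{2m}(\arcsin\eta_\ell)^{2m}}{(2m)!}.$$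
   Context: The principal argument satisfies $-\pi<\operatorname{Arg}w\le\pi$; $\arcsin$ is the principal inverse sine $\arcsin w=-i\operatorname{Log}(iw+\sqrt{1-w^2})$ with principal logarithm and principal square root (so $\sqrt{-1}=i$). For integers $n\ge0$, $m\ge0$, the finite repeated-$2$ sums are $$\zeta_n(\{2\}^m):=\sum_{n\ge n_1>\cdots>n_m\ge1}\frac1{n_1^2\cdots n_m^2},\qquad t_n(\{2\}^m):=\sum_{n\ge n_1>\cdots>n_m\ge1}\frac1{(2n_1-1)^2\cdots(2n_m-1)^2},$$ with the value $1$ when $m=0$ and the value $0$ when $m>n$. *)

theory Defs
  imports "HOL-Analysis.Analysis" "HOL-Number_Theory.Cong"
begin

text \<open>The tuples \<open>n \<ge> n\<^sub>1 > \<dots> > n\<^sub>m \<ge> 1\<close>, represented as lists \<open>[n\<^sub>1, \<dots>, n\<^sub>m]\<close>.\<close>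

definition decr_tuples :: "nat \<Rightarrow> nat \<Rightarrow> nat list set" where
  "decr_tuples n m = {ns. length ns = m \<and> sorted_wrt (>) ns \<and> set ns \<subseteq> {1..n}}"

definition zeta_sum2 :: "nat \<Rightarrow> nat \<Rightarrow> real" where
  "zeta_sum2 n m = (\<Sum>ns\<in>decr_tuples n m. 1 / (\<Prod>k\<leftarrow>ns. (real k)\<^sup>2))"

definition t_sum2 :: "nat \<Rightarrow> nat \<Rightarrow> real" where
  "t_sum2 n m = (\<Sum>ns\<in>decr_tuples n m. 1 / (\<Prod>k\<leftarrow>ns. (2 * real k - 1)\<^sup>2))"

lemma finite_decr_tuples: "finite (decr_tuples n m)"
  by (rule finite_subset[OF _ finite_lists_length_eq[of "{1..n}" m]])
     (auto simp: decr_tuples_def)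

lemma decr_tuples_0: "decr_tuples n 0 = {[]}"
  by (auto simp: decr_tuples_def)

lemma decr_tuples_empty:
  assumes "m > n"
  shows "decr_tuples n m = {}"
proof -
  have "length ns \<le> n" if "sorted_wrt (>) ns" "set ns \<subseteq> {1..n}" for ns :: "nat list"
  proof -
    have "distinct ns"
      using that(1) by (induction ns) auto
    then have "length ns = card (set ns)"
      by (simp add: distinct_card)
    also have "\<dots> \<le> n"
      using card_mono[OF _ that(2)] by simp
    finally show ?thesis .
  qed
  with assms show ?thesis
    by (force simp: decr_tuples_def)
qed

lemma sums2_0: "zeta_sum2 n 0 = 1" "t_sum2 n 0 = 1"
  by (simp_all add: zeta_sum2_def t_sum2_def decr_tuples_0)

lemma sums2_eq_0: "m > n \<Longrightarrow> zeta_sum2 n m = 0" "m > n \<Longrightarrow> t_sum2 n m = 0"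
  by (simp_all add: zeta_sum2_def t_sum2_def decr_tuples_empty)

end

theory Submission
  imports Defs "HOL-Complex_Analysis.Complex_Analysis"
begin

text \<open>
  The functions \<open>f\<^sub>k(z) = (arcsin z)\<^sup>k / k!\<close> satisfy
  \<open>(1 - z\<^sup>2) f\<^sub>k'' - z f\<^sub>k' = f\<^sub>k\<^sub>-\<^sub>2\<close> on the unit disc. On Taylor coefficients this is the recurrence
  \<open>(n + 2) (n + 1) a\<^sub>k(n + 2) = n\<^sup>2 a\<^sub>k(n) + a\<^sub>k\<^sub>-\<^sub>2(n)\<close>, which the binomial weights times the repeated-2 sums
  also satisfy. The coefficients are nonnegative and \<open>arcsin\<close> is bounded near \<open>1\<close>, so the Taylor series
  converge absolutely on the unit circle, where Abel's limit theorem identifies their values.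
  As \<open>\<eta>\<^sub>l\<^sup>2 = \<omega>\<^sup>l\<close>, averaging over the \<open>q\<close>-th roots of unity extracts the residue class of \<open>r\<close>.
\<close>

section \<open>Recurrences for the repeated-2 sums\<close>

text \<open>The first entry is the largest: if it is \<open>Suc n\<close>, deleting it leaves a
  tuple bounded by \<open>n\<close>; otherwise the whole tuple is already bounded by
  \<open>n\<close>.\<close>

lemma decr_tuples_Suc_Suc:
  "decr_tuples (Suc n) (Suc m) = decr_tuples n (Suc m) \<union> (#) (Suc n) ` decr_tuples n m"
proof (intro equalityI subsetI)
  fix ns assume "ns \<in> decr_tuples (Suc n) (Suc m)"
  then obtain x xs where ns: "ns = x # xs" and len: "length xs = m"
    and sorted: "sorted_wrt (>) xs" and lt: "\<forall>y\<in>set xs. y < x"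
    and sub: "set xs \<subseteq> {1..Suc n}" and x: "1 \<le> x" "x \<le> Suc n"
    by (cases ns) (auto simp: decr_tuples_def)
  show "ns \<in> decr_tuples n (Suc m) \<union> (#) (Suc n) ` decr_tuples n m"
  proof (cases "x = Suc n")
    case True
    with lt sub have "set xs \<subseteq> {1..n}" by force
    with True ns len sorted show ?thesis by (auto simp: decr_tuples_def)
  next
    case False
    with x have "x \<le> n" by simp
    moreover from this lt sub have "set xs \<subseteq> {1..n}" by force
    ultimately show ?thesis using ns len sorted lt x by (auto simp: decr_tuples_def)
  qed
qed (force simp: decr_tuples_def)+

text \<open>A general weight \<open>g\<close> serves both families: squares for
  \<open>zeta_sum2\<close>, odd squares for \<open>t_sum2\<close>.\<close>

lemma sum_decr_tuples_Suc_Suc: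
  fixes g :: "nat \<Rightarrow> real"
  shows "(\<Sum>ns\<in>decr_tuples (Suc n) (Suc m). 1 / (\<Prod>k\<leftarrow>ns. g k)) =
         (\<Sum>ns\<in>decr_tuples n (Suc m). 1 / (\<Prod>k\<leftarrow>ns. g k)) +
         (\<Sum>ns\<in>decr_tuples n m. 1 / (\<Prod>k\<leftarrow>ns. g k)) / g (Suc n)"
proof -
  have disj: "decr_tuples n (Suc m) \<inter> (#) (Suc n) ` decr_tuples n m = {}"
    by (auto simp: decr_tuples_def)
  show ?thesis
    unfolding decr_tuples_Suc_Suc
    by (subst sum.union_disjoint[OF _ _ disj])
       (simp_all add: finite_decr_tuples sum.reindex sum_divide_distrib mult.commute)
qed

lemma zeta_sum2_Suc_Suc:
  "zeta_sum2 (Suc n) (Suc m) = zeta_sum2 n (Suc m) + zeta_sum2 n m / (real (Suc n))\<^sup>2"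
  unfolding zeta_sum2_def by (rule sum_decr_tuples_Suc_Suc)

lemma t_sum2_Suc_Suc:
  "t_sum2 (Suc n) (Suc m) = t_sum2 n (Suc m) + t_sum2 n m / (2 * real n + 1)\<^sup>2"
  using sum_decr_tuples_Suc_Suc[where g = "\<lambda>k. (2 * real k - 1)\<^sup>2"]
  by (simp add: t_sum2_def algebra_simps)

lemma zeta_sum2_nonneg: "zeta_sum2 n m \<ge> 0"
  unfolding zeta_sum2_def by (auto intro!: sum_nonneg prod_list_nonneg)

lemma t_sum2_nonneg: "t_sum2 n m \<ge> 0"
  unfolding t_sum2_def by (auto intro!: sum_nonneg prod_list_nonneg)

section \<open>Ratios of consecutive binomial weights\<close>

lemma central_binomial_Suc:
  "real (n + 1) * real ((2 * Suc n) choose Suc n) = 2 * (2 * real n + 1) * real ((2 * n) choose n)"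
proof -
  have 1: "real ((2 * Suc n) choose Suc n) = fact (2 * Suc n) / (fact (Suc n) * fact (2 * Suc n - Suc n))"
    by (rule binomial_fact) simp
  have 2: "real ((2 * n) choose n) = fact (2 * n) / (fact n * fact (2 * n - n))"
    by (rule binomial_fact) simp
  show ?thesis
    unfolding 1 2 by (simp add: divide_simps) (simp add: algebra_simps)
qed

text \<open>This is the homogeneous part of the Taylor recurrence, taken at the odd index
  \<open>2 * n + 1\<close>.\<close>

lemma t_weight_Suc:
  fixes n :: nat
  defines "b \<equiv> \<lambda>n. real ((2 * n) choose n) / (4 ^ n * (2 * real n + 1))"
  shows "(2 * real n + 3) * (2 * real n + 2) * b (Suc n) = (2 * real n + 1)\<^sup>2 * b n"
proof -
  define c where "c = real ((2 * n) choose n)"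
  have *: "real ((2 * Suc n) choose Suc n) = 2 * (2 * real n + 1) * c / (real n + 1)"
    using central_binomial_Suc[of n] by (simp add: c_def field_simps)
  have **: "2 * real n + 3 \<noteq> 0" "real n + 1 \<noteq> 0" "2 * real n + 1 \<noteq> 0"
    by (simp_all add: add_eq_0_iff_both_eq_0)
  have [simp]: "2 * real (Suc n) + 1 = 2 * real n + 3" by simp
  show ?thesis
    using ** unfolding b_def * c_def[symmetric]
    by (simp add: divide_simps power2_eq_square del: of_nat_Suc) (simp add: algebra_simps)
qed

text \<open>The same homogeneous recurrence at the even index \<open>2 * n\<close>. It fails at
  \<open>n = 0\<close>, where division by zero makes \<open>d 0 = 0\<close> although
  \<open>d 1 = 2\<close>.\<close>

lemma zeta_weight_Suc:
  fixes n :: nat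
  defines "d \<equiv> \<lambda>n. 4 ^ n / ((real n)\<^sup>2 * real ((2 * n) choose n))"
  assumes "n \<ge> 1"
  shows "(2 * real n + 2) * (2 * real n + 1) * d (Suc n) = (2 * real n)\<^sup>2 * d n"
proof -
  define c where "c = real ((2 * n) choose n)"
  have *: "real ((2 * Suc n) choose Suc n) = 2 * (2 * real n + 1) * c / (real n + 1)"
    using central_binomial_Suc[of n] by (simp add: c_def field_simps)
  have **: "real n \<noteq> 0" "real n + 1 \<noteq> 0" "2 * real n + 1 \<noteq> 0" "c \<noteq> 0"
    using assms by (simp_all add: add_eq_0_iff_both_eq_0 c_def)
  have [simp]: "real (Suc n) = real n + 1" by simp
  show ?thesis
    using ** unfolding d_def * c_def[symmetric]
    by (simp add: divide_simps power2_eq_square del: of_nat_Suc) (simp add: algebra_simps)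
qed

section \<open>From the differential equation to recurrences for Taylor coefficients\<close>

text \<open>The terms \<open>z^2 f''\<close> and \<open>z f'\<close> contribute
  \<open>n (n - 1)\<close> and \<open>n\<close> times the n-th coefficient of \<open>f\<close>,
  which add up to \<open>n^2\<close>.\<close>

lemma fps_nth_recurrence_of_ode:
  fixes f h :: "complex \<Rightarrow> complex"
  assumes hol: "f holomorphic_on ball 0 1" "h holomorphic_on ball 0 1"
    and ode: "\<And>z. z \<in> ball 0 1 \<Longrightarrow> (1 - z\<^sup>2) * deriv (deriv f) z - z * deriv f z = h z"
  shows "of_nat ((n + 2) * (n + 1)) * fps_nth (fps_expansion f 0) (n + 2) =
         of_nat (n\<^sup>2) * fps_nth (fps_expansion f 0) n + fps_nth (fps_expansion h 0) n"
proof -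
  define F where "F = fps_expansion f 0"
  define H where "H = fps_expansion h 0"
  have F: "f has_fps_expansion F" and H: "h has_fps_expansion H"
    unfolding F_def H_def using hol by (auto intro!: has_fps_expansion_fps_expansion[of "ball 0 1"])
  have "(\<lambda>z. deriv (deriv f) z - z * (z * deriv (deriv f) z) - z * deriv f z) has_fps_expansion
        fps_deriv (fps_deriv F) - fps_X * (fps_X * fps_deriv (fps_deriv F)) - fps_X * fps_deriv F"
    by (intro fps_expansion_intros F)
  moreover have "eventually (\<lambda>z. deriv (deriv f) z - z * (z * deriv (deriv f) z) - z * deriv f z = h z) (nhds 0)"
  proof -
    have "eventually (\<lambda>z::complex. z \<in> ball 0 1) (nhds 0)"
      by (intro eventually_nhds_in_open) auto
    then show ?thesis
      by eventually_elim (use ode in \<open>simp add: algebra_simps power2_eq_square\<close>)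
  qed
  ultimately have "h has_fps_expansion
        fps_deriv (fps_deriv F) - fps_X * (fps_X * fps_deriv (fps_deriv F)) - fps_X * fps_deriv F"
    by (subst (asm) has_fps_expansion_cong) auto
  then have eq: "fps_deriv (fps_deriv F) - fps_X * (fps_X * fps_deriv (fps_deriv F)) - fps_X * fps_deriv F = H"
    using H fps_expansion_unique_complex by blast
  have "of_nat ((n + 2) * (n + 1)) * fps_nth F (n + 2) = of_nat (n\<^sup>2) * fps_nth F n + fps_nth H n"
  \<comment> \<open>Two factors \<open>fps_X\<close> shift the index by two, so
    \<open>z^2 f''\<close> has no coefficient at 0 and 1; this agrees with
    \<open>n (n - 1) = 0\<close> there.\<close>
  proof (cases "n \<ge> 2")
    case True
    then obtain k where n: "n = Suc (Suc k)" by (metis Suc_le_D le_Suc_ex add_2_eq_Suc)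
    show ?thesis
      unfolding eq[symmetric] n by (simp add: algebra_simps power2_eq_square)
  next
    case False
    then have "n = 0 \<or> n = 1" by auto
    then show ?thesis
      unfolding eq[symmetric] by (auto simp: algebra_simps)
  qed
  then show ?thesis unfolding F_def H_def .
qed

text \<open>With the factorial in the denominator, differentiation lowers \<open>k\<close> by one
  and produces no numerical factor, only \<open>1 / cos (Arcsin z)\<close>.\<close>

definition arcsin_pow :: "nat \<Rightarrow> complex \<Rightarrow> complex" where
  "arcsin_pow k z = Arcsin z ^ k / fact k"

definition arcsin_coeff :: "nat \<Rightarrow> nat \<Rightarrow> complex" where
  "arcsin_coeff k n = fps_nth (fps_expansion (arcsin_pow k) 0) n"

lemma Re_less_1_if_in_ball: "z \<in> ball 0 1 \<Longrightarrow> \<bar>Re z\<bar> < 1"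
  using abs_Re_le_cmod[of z] by simp

lemma holomorphic_arcsin_pow: "arcsin_pow k holomorphic_on ball 0 1"
  unfolding arcsin_pow_def
  by (intro holomorphic_intros holomorphic_on_Arcsin) (auto intro: Re_less_1_if_in_ball)

lemma cos_Arcsin_nonzero_ball:
  assumes "z \<in> ball 0 1"
  shows "cos (Arcsin z) \<noteq> 0"
proof (rule cos_Arcsin_nonzero)
  show "z\<^sup>2 \<noteq> 1"
    using assms by (auto simp: power2_eq_1_iff)
qed

text \<open>On the disc \<open>cos (Arcsin z)\<close> plays the role of the square root of
  \<open>1 - z^2\<close>, so no branch of the root has to be tracked.\<close>

lemma cos_Arcsin_squared: "(cos (Arcsin z))\<^sup>2 = 1 - z\<^sup>2"
  by (simp add: cos_squared_eq)

lemma DERIV_arcsin_pow_Suc: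
  assumes "z \<in> ball 0 1"
  shows "(arcsin_pow (Suc k) has_field_derivative arcsin_pow k z / cos (Arcsin z)) (at z)"
proof -
  have "(Arcsin has_field_derivative inverse (cos (Arcsin z))) (at z)"
    by (rule has_field_derivative_Arcsin) (rule Re_less_1_if_in_ball[OF assms])
  from DERIV_cdivide[OF DERIV_power_Suc[OF this], of k "fact (Suc k)"]
  have "(arcsin_pow (Suc k) has_field_derivative
          of_nat (Suc k) * (inverse (cos (Arcsin z)) * Arcsin z ^ k) / fact (Suc k)) (at z)"
    unfolding arcsin_pow_def by simp
  also have "of_nat (Suc k) * (inverse (cos (Arcsin z)) * Arcsin z ^ k) / fact (Suc k)
               = arcsin_pow k z / cos (Arcsin z)"
    unfolding arcsin_pow_def fact_Suc by (simp add: divide_inverse del: of_nat_Suc)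
  finally show ?thesis .
qed

lemma deriv_arcsin_pow_Suc:
  assumes "z \<in> ball 0 1"
  shows "deriv (arcsin_pow (Suc k)) z = arcsin_pow k z / cos (Arcsin z)"
  using DERIV_arcsin_pow_Suc[OF assms] by (rule DERIV_imp_deriv)

lemma arcsin_pow_0: "arcsin_pow 0 = (\<lambda>_. 1)"
  by (simp add: arcsin_pow_def fun_eq_iff)

lemma DERIV_inverse_cos_Arcsin:
  assumes "z \<in> ball 0 1"
  shows "((\<lambda>z. inverse (cos (Arcsin z))) has_field_derivative z / (cos (Arcsin z)) ^ 3) (at z)"
  using assms cos_Arcsin_nonzero_ball[OF assms]
  by (auto intro!: derivative_eq_intros Re_less_1_if_in_ball simp: divide_simps power3_eq_cube)

text \<open>The derivative of \<open>arcsin_pow k\<close> is left as a parameter \<open>D\<close> so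
  that the constant case \<open>k = 0\<close> and the successor case are both covered.\<close>

lemma deriv2_arcsin_pow:
  assumes z: "z \<in> ball 0 1"
    and D: "(arcsin_pow k has_field_derivative D) (at z)"
  shows "deriv (deriv (arcsin_pow (Suc k))) z =
           D / cos (Arcsin z) + arcsin_pow k z * z / (cos (Arcsin z)) ^ 3"
proof -
  have "eventually (\<lambda>w::complex. w \<in> ball 0 1) (nhds z)"
    using z by (intro eventually_nhds_in_open) auto
  then have "eventually (\<lambda>w. deriv (arcsin_pow (Suc k)) w = arcsin_pow k w * inverse (cos (Arcsin w))) (nhds z)"
    by eventually_elim (simp add: deriv_arcsin_pow_Suc divide_inverse)
  then have "deriv (deriv (arcsin_pow (Suc k))) z =
             deriv (\<lambda>w. arcsin_pow k w * inverse (cos (Arcsin w))) z"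
    by (rule deriv_cong_ev) simp
  also have "\<dots> = D / cos (Arcsin z) + arcsin_pow k z * z / (cos (Arcsin z)) ^ 3"
    by (rule DERIV_imp_deriv)
       (use DERIV_mult[OF D DERIV_inverse_cos_Arcsin[OF z]] in \<open>simp add: divide_inverse mult_ac add_ac\<close>)
  finally show ?thesis .
qed

text \<open>With \<open>c = cos (Arcsin z)\<close>, the function of index \<open>k + 2\<close> has
  first derivative \<open>arcsin_pow (k + 1) z / c\<close> and second derivative
  \<open>arcsin_pow k z / c^2 + z * arcsin_pow (k + 1) z / c^3\<close>. Multiplying the latter by
  \<open>1 - z^2 = c^2\<close> and subtracting \<open>z\<close> times the former leaves
  \<open>arcsin_pow k z\<close>.\<close>

lemma arcsin_coeff_recurrence:
  "of_nat ((n + 2) * (n + 1)) * arcsin_coeff (Suc (Suc k)) (n + 2) =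
     of_nat (n\<^sup>2) * arcsin_coeff (Suc (Suc k)) n + arcsin_coeff k n"
  unfolding arcsin_coeff_def
proof (rule fps_nth_recurrence_of_ode[OF holomorphic_arcsin_pow holomorphic_arcsin_pow])
  fix z :: complex assume z: "z \<in> ball 0 1"
  define c where "c = cos (Arcsin z)"
  have c: "c \<noteq> 0" "1 - z\<^sup>2 = c\<^sup>2"
    using cos_Arcsin_nonzero_ball[OF z] cos_Arcsin_squared[of z] by (simp_all add: c_def)
  show "(1 - z\<^sup>2) * deriv (deriv (arcsin_pow (Suc (Suc k)))) z
          - z * deriv (arcsin_pow (Suc (Suc k))) z = arcsin_pow k z"
    unfolding deriv2_arcsin_pow[OF z DERIV_arcsin_pow_Suc[OF z]] deriv_arcsin_pow_Suc[OF z]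
      c_def[symmetric] c(2)
    using c(1) by (simp add: field_simps power2_eq_square power3_eq_cube)
qed

text \<open>The same equation with right-hand side 0, since \<open>arcsin_pow 0\<close> is
  constant.\<close>

lemma arcsin_coeff_1_recurrence:
  "of_nat ((n + 2) * (n + 1)) * arcsin_coeff 1 (n + 2) = of_nat (n\<^sup>2) * arcsin_coeff 1 n"
proof -
  have "of_nat ((n + 2) * (n + 1)) * fps_nth (fps_expansion (arcsin_pow 1) 0) (n + 2) =
        of_nat (n\<^sup>2) * fps_nth (fps_expansion (arcsin_pow 1) 0) n + fps_nth (fps_expansion (\<lambda>_. 0) 0) n"
  proof (rule fps_nth_recurrence_of_ode[OF holomorphic_arcsin_pow])
    fix z :: complex assume z: "z \<in> ball 0 1"
    define c where "c = cos (Arcsin z)"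
    have c: "c \<noteq> 0" "1 - z\<^sup>2 = c\<^sup>2"
      using cos_Arcsin_nonzero_ball[OF z] cos_Arcsin_squared[of z] by (simp_all add: c_def)
    have D: "(arcsin_pow 0 has_field_derivative 0) (at z)"
      by (simp add: arcsin_pow_0)
    show "(1 - z\<^sup>2) * deriv (deriv (arcsin_pow 1)) z - z * deriv (arcsin_pow 1) z = 0"
      unfolding One_nat_def deriv2_arcsin_pow[OF z D] deriv_arcsin_pow_Suc[OF z] c_def[symmetric] c(2)
      using c(1) by (simp add: field_simps power2_eq_square power3_eq_cube)
  qed auto
  then show ?thesis by (simp add: arcsin_coeff_def fps_expansion_def)
qed

text \<open>The recurrences advance \<open>n\<close> by two, so the coefficients at 0 and 1 are
  their initial values.\<close>

lemma arcsin_coeff_at_0: "arcsin_coeff k 0 = (if k = 0 then 1 else 0)"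
  by (simp add: arcsin_coeff_def fps_expansion_def arcsin_pow_def)

lemma arcsin_coeff_at_1: "arcsin_coeff k 1 = (if k = 1 then 1 else 0)"
proof (cases k)
  case 0
  then show ?thesis by (simp add: arcsin_coeff_def fps_expansion_def arcsin_pow_0)
next
  case (Suc j)
  then show ?thesis
    by (simp add: arcsin_coeff_def fps_expansion_def deriv_arcsin_pow_Suc) (simp add: arcsin_pow_def)
qed

lemma arcsin_coeff_0_Suc: "arcsin_coeff 0 (Suc n) = 0"
  by (simp add: arcsin_coeff_def arcsin_pow_0 fps_expansion_def higher_deriv_const del: funpow.simps)

text \<open>The recurrence only links coefficients with the same parity of \<open>k + n\<close>, and
  the initial values of odd parity vanish.\<close>

lemma arcsin_coeff_eq_0_if_odd: "odd (k + n) \<Longrightarrow> arcsin_coeff k n = 0"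
proof (induction k arbitrary: n rule: induct_nat_012)
  case 0
  then show ?case by (cases n) (auto simp: arcsin_coeff_0_Suc)
next
  case 1
  then show ?case
  proof (induction n rule: induct_nat_012)
    case (ge2 n)
    moreover have "of_nat ((n + 2) * (n + 1)) \<noteq> (0::complex)"
      unfolding of_nat_eq_0_iff by simp
    ultimately show ?case using arcsin_coeff_1_recurrence[of n] by simp
  qed (auto simp: arcsin_coeff_at_0)
next
  case (ge2 k)
  from ge2.prems show ?case
  proof (induction n rule: induct_nat_012)
    case (ge2 n)
    moreover have "of_nat ((n + 2) * (n + 1)) \<noteq> (0::complex)"
      unfolding of_nat_eq_0_iff by simp
    ultimately show ?case
      using arcsin_coeff_recurrence[of n k] \<open>\<And>n. odd (k + n) \<Longrightarrow> arcsin_coeff k n = 0\<close>[of n]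
      by simp
  qed (auto simp: arcsin_coeff_at_0 arcsin_coeff_at_1[unfolded One_nat_def])
qed

section \<open>Closed forms of the Taylor coefficients\<close>

text \<open>Both sides obey the same recurrence in \<open>n\<close> with the same initial value; the
  outer induction on \<open>m\<close> supplies the inhomogeneous term.\<close>

lemma arcsin_coeff_odd:
  "arcsin_coeff (2 * m + 1) (2 * n + 1) =
     of_real (real ((2 * n) choose n) / (4 ^ n * (2 * real n + 1)) * t_sum2 n m)"
  (is "_ = of_real (?b n * _)")
proof (induction m arbitrary: n)
  case 0
  show ?case
  proof (induction n)
    case 0
    then show ?case using arcsin_coeff_at_1[of 1] by (simp add: sums2_0)
  next
    case (Suc n)
    have "of_nat ((2 * n + 3) * (2 * n + 2)) * arcsin_coeff 1 (2 * Suc n + 1)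
            = of_nat ((2 * n + 1)\<^sup>2) * arcsin_coeff 1 (2 * n + 1)"
      using arcsin_coeff_1_recurrence[of "2 * n + 1"] by (simp add: eval_nat_numeral)
    also have "\<dots> = of_real ((2 * real n + 1)\<^sup>2 * ?b n)"
      using Suc.IH by (simp add: sums2_0 add.commute)
    also have "\<dots> = of_nat ((2 * n + 3) * (2 * n + 2)) * of_real (?b (Suc n))"
      by (subst t_weight_Suc[symmetric]) (simp del: binomial_Suc_Suc add: algebra_simps)
    finally have "arcsin_coeff 1 (2 * Suc n + 1) = of_real (?b (Suc n))"
      by (subst (asm) mult_cancel_left) (auto simp del: of_nat_mult of_nat_add)
    then show ?case by (simp add: sums2_0)
  qed
next
  case (Suc m)
  note IH = Suc.IH
  show ?case
  proof (induction n)
    case 0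
    then show ?case using arcsin_coeff_at_1[of "2 * Suc m + 1"] by (simp add: sums2_eq_0)
  next
    case (Suc n)
    let ?k = "2 * Suc m + 1"
    have "of_nat ((2 * n + 3) * (2 * n + 2)) * arcsin_coeff ?k (2 * Suc n + 1)
            = of_nat ((2 * n + 1)\<^sup>2) * arcsin_coeff ?k (2 * n + 1) + arcsin_coeff (2 * m + 1) (2 * n + 1)"
      using arcsin_coeff_recurrence[of "2 * n + 1" "2 * m + 1"] by (simp add: eval_nat_numeral)
    \<comment> \<open>Pulling out \<open>(2 * real n + 1)^2\<close> puts the inhomogeneous term over
      that square, which is exactly the increment of \<open>t_sum2\<close>.\<close>
    also have "\<dots> = of_real ((2 * real n + 1)\<^sup>2 * ?b n * (t_sum2 n (Suc m) + t_sum2 n m / (2 * real n + 1)\<^sup>2))"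
    proof -
      have "2 * real n + 1 \<noteq> 0" by (simp add: add_eq_0_iff_both_eq_0)
      then have "(2 * real n + 1)\<^sup>2 * ?b n * (t_sum2 n (Suc m) + t_sum2 n m / (2 * real n + 1)\<^sup>2)
              = (2 * real n + 1)\<^sup>2 * (?b n * t_sum2 n (Suc m)) + ?b n * t_sum2 n m"
        by (simp add: distrib_left)
      then show ?thesis
        unfolding Suc.IH IH by (simp only: of_real_add of_real_mult) (simp add: add.commute)
    qed
    also have "\<dots> = of_nat ((2 * n + 3) * (2 * n + 2)) * of_real (?b (Suc n) * t_sum2 (Suc n) (Suc m))"
    proof -
      have weight: "(2 * real n + 1)\<^sup>2 * ?b n = real ((2 * n + 3) * (2 * n + 2)) * ?b (Suc n)"
        by (subst t_weight_Suc[symmetric]) (simp add: algebra_simps del: binomial_Suc_Suc)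
      show ?thesis
        unfolding weight t_sum2_Suc_Suc[symmetric] by (simp only: of_real_mult of_real_of_nat_eq mult.assoc)
    qed
    finally show "arcsin_coeff ?k (2 * Suc n + 1) = of_real (?b (Suc n) * t_sum2 (Suc n) (Suc m))"
      by (subst (asm) mult_cancel_left) (auto simp del: of_nat_mult of_nat_add)
  qed
qed

text \<open>The index starts at \<open>Suc n\<close> to avoid the degenerate weight at 0. The power
  of 2 grows by 4 with each step in \<open>m\<close>, matching the 4 in
  \<open>(2 * real (Suc n))^2\<close>.\<close>

lemma arcsin_coeff_even:
  "2 ^ (2 * Suc m) * arcsin_coeff (2 * Suc m) (2 * Suc n) =
     of_real (4 ^ Suc n / ((real (Suc n))\<^sup>2 * real ((2 * Suc n) choose Suc n)) * zeta_sum2 n m)"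
  (is "_ = of_real (?d (Suc n) * _)")
proof (induction m arbitrary: n)
  case 0
  show ?case
  proof (induction n)
    case 0
    \<comment> \<open>Only here does the constant term of \<open>arcsin_pow 0\<close> enter: the
      quadratic coefficient is 1/2, and \<open>4 * (1/2) = 2 = ?d 1\<close>.\<close>
    then show ?case using arcsin_coeff_recurrence[of 0 0]
      by (simp add: sums2_0 arcsin_coeff_at_0 eval_nat_numeral)
  next
    case (Suc n)
    have "of_nat ((2 * n + 4) * (2 * n + 3)) * (2 ^ (2 * Suc 0) * arcsin_coeff (2 * Suc 0) (2 * Suc (Suc n)))
            = of_nat ((2 * n + 2)\<^sup>2) * (2 ^ (2 * Suc 0) * arcsin_coeff (2 * Suc 0) (2 * Suc n))"
      using arcsin_coeff_recurrence[of "2 * n + 2" 0] by (simp add: eval_nat_numeral arcsin_coeff_0_Suc)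
    also have "\<dots> = of_real ((2 * real (Suc n))\<^sup>2 * ?d (Suc n))"
      unfolding Suc.IH by (simp add: sums2_0)
    also have "\<dots> = of_nat ((2 * n + 4) * (2 * n + 3)) * of_real (?d (Suc (Suc n)))"
      by (subst zeta_weight_Suc[symmetric]) (simp_all add: algebra_simps)
    finally have "2 ^ (2 * Suc 0) * arcsin_coeff (2 * Suc 0) (2 * Suc (Suc n)) = of_real (?d (Suc (Suc n)))"
      by (subst (asm) mult_cancel_left) (auto simp del: of_nat_mult of_nat_add)
    then show ?case by (simp only: sums2_0 mult_1_right)
  qed
next
  case (Suc m)
  note IH = Suc.IH
  show ?case
  proof (induction n)
    case 0
    then show ?case using arcsin_coeff_recurrence[of 0 "2 * Suc m"]
      by (simp add: sums2_eq_0 arcsin_coeff_at_0 eval_nat_numeral)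
  next
    case (Suc n)
    let ?k = "2 * Suc (Suc m)"
    have "of_nat ((2 * n + 4) * (2 * n + 3)) * arcsin_coeff ?k (2 * Suc (Suc n))
            = of_nat ((2 * n + 2)\<^sup>2) * arcsin_coeff ?k (2 * Suc n) + arcsin_coeff (2 * Suc m) (2 * Suc n)"
      using arcsin_coeff_recurrence[of "2 * n + 2" "2 * Suc m"] by (simp add: eval_nat_numeral)
    then have "of_nat ((2 * n + 4) * (2 * n + 3)) * (2 ^ ?k * arcsin_coeff ?k (2 * Suc (Suc n)))
            = of_nat ((2 * n + 2)\<^sup>2) * (2 ^ ?k * arcsin_coeff ?k (2 * Suc n))
              + 4 * (2 ^ (2 * Suc m) * arcsin_coeff (2 * Suc m) (2 * Suc n))"
      by (simp add: algebra_simps)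
    also have "\<dots> = of_real ((2 * real (Suc n))\<^sup>2 * ?d (Suc n)
                    * (zeta_sum2 n (Suc m) + zeta_sum2 n m / (real (Suc n))\<^sup>2))"
    proof -
      have "(2 * real (Suc n))\<^sup>2 * ?d (Suc n) * (zeta_sum2 n (Suc m) + zeta_sum2 n m / (real (Suc n))\<^sup>2)
              = (2 * real (Suc n))\<^sup>2 * (?d (Suc n) * zeta_sum2 n (Suc m)) + 4 * (?d (Suc n) * zeta_sum2 n m)"
        by (simp add: distrib_left add_divide_distrib power_mult_distrib mult_ac del: of_nat_Suc binomial_Suc_Suc)
      then show ?thesis
        unfolding Suc.IH IH by (simp only: of_real_add of_real_mult) simp
    qed
    also have "\<dots> = of_nat ((2 * n + 4) * (2 * n + 3)) * of_real (?d (Suc (Suc n)) * zeta_sum2 (Suc n) (Suc m))"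
    proof -
      have weight: "(2 * real (Suc n))\<^sup>2 * ?d (Suc n) = real ((2 * n + 4) * (2 * n + 3)) * ?d (Suc (Suc n))"
        by (subst zeta_weight_Suc[symmetric]) (simp_all add: algebra_simps)
      show ?thesis
        unfolding weight zeta_sum2_Suc_Suc[symmetric] by (simp only: of_real_mult of_real_of_nat_eq mult.assoc)
    qed
    finally show "2 ^ ?k * arcsin_coeff ?k (2 * Suc (Suc n))
        = of_real (?d (Suc (Suc n)) * zeta_sum2 (Suc n) (Suc m))"
      by (subst (asm) mult_cancel_left) (auto simp del: of_nat_mult of_nat_add)
  qed
qed

section \<open>Power series on the open unit disc\<close>

lemma arcsin_pow_sums:
  assumes "z \<in> ball 0 1"
  shows "(\<lambda>n. arcsin_coeff k n * z ^ n) sums arcsin_pow k z"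
  using holomorphic_power_series[OF holomorphic_arcsin_pow assms]
  by (simp add: arcsin_coeff_def fps_expansion_def)

lemma arcsin_pow_odd_sums:
  assumes "z \<in> ball 0 1"
  shows "(\<lambda>n. of_real (real ((2 * n) choose n) / (4 ^ n * (2 * real n + 1)) * t_sum2 n m) * z ^ (2 * n + 1))
           sums arcsin_pow (2 * m + 1) z"
proof -
  have "strict_mono (\<lambda>n::nat. 2 * n + 1)"
    by (auto simp: strict_mono_def)
  moreover have "arcsin_coeff (2 * m + 1) n * z ^ n = 0" if "n \<notin> range (\<lambda>n. 2 * n + 1)" for n
    using that by (auto intro!: arcsin_coeff_eq_0_if_odd elim!: oddE)
  ultimately show ?thesis
    using sums_mono_reindex[of "\<lambda>n. 2 * n + 1" "\<lambda>n. arcsin_coeff (2 * m + 1) n * z ^ n"]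
      arcsin_pow_sums[OF assms, of "2 * m + 1"]
    unfolding arcsin_coeff_odd by blast
qed

lemma arcsin_pow_even_sums:
  assumes "z \<in> ball 0 1" and "m \<ge> 1"
  shows "(\<lambda>n. of_real (4 ^ n / ((real n)\<^sup>2 * real ((2 * n) choose n)) * zeta_sum2 (n - 1) (m - 1)) * z ^ (2 * n))
           sums (2 ^ (2 * m) * arcsin_pow (2 * m) z)"
proof -
  obtain j where m: "m = Suc j"
    using assms(2) by (cases m) auto
  have "strict_mono (\<lambda>n::nat. 2 * n)"
    by (auto simp: strict_mono_def)
  moreover have "arcsin_coeff (2 * m) n * z ^ n = 0" if "n \<notin> range (\<lambda>n. 2 * n)" for n
  proof -
    from that have "odd n" by (metis evenE rangeI)
    then show ?thesis by (simp add: arcsin_coeff_eq_0_if_odd)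
  qed
  ultimately have "(\<lambda>n. arcsin_coeff (2 * m) (2 * n) * z ^ (2 * n)) sums arcsin_pow (2 * m) z"
    using sums_mono_reindex[of "\<lambda>n. 2 * n" "\<lambda>n. arcsin_coeff (2 * m) n * z ^ n"]
      arcsin_pow_sums[OF assms(1), of "2 * m"] by blast
  then have "(\<lambda>n. 2 ^ (2 * m) * (arcsin_coeff (2 * m) (2 * n) * z ^ (2 * n)))
               sums (2 ^ (2 * m) * arcsin_pow (2 * m) z)"
    by (rule sums_mult)
  moreover have "2 ^ (2 * m) * (arcsin_coeff (2 * m) (2 * n) * z ^ (2 * n)) =
      of_real (4 ^ n / ((real n)\<^sup>2 * real ((2 * n) choose n)) * zeta_sum2 (n - 1) (m - 1)) * z ^ (2 * n)" for n
  proof (cases n)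
    case 0
    \<comment> \<open>The weight at 0 is 0 by division by zero, in accordance with the vanishing
      constant term of a positive power of \<open>Arcsin\<close>.\<close>
    then show ?thesis using m by (simp add: arcsin_coeff_at_0)
  next
    case (Suc i)
    show ?thesis
      unfolding Suc m mult.assoc[symmetric] arcsin_coeff_even by simp
  qed
  ultimately show ?thesis by simp
qed

section \<open>Passage to the unit circle\<close>

text \<open>Nonnegativity and the radial limit at 1 force \<open>a\<close> to be summable. The
  series is then continuous on the closed disc, so its boundary values are the radial limits of
  \<open>F\<close>. The free exponent \<open>e\<close> admits odd and even series alike.\<close>

lemma Abel_nonneg_boundary:
  fixes a :: "nat \<Rightarrow> real" and e :: "nat \<Rightarrow> nat" and F :: "complex \<Rightarrow> complex"
  assumes nonneg: "\<And>n. a n \<ge> 0"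
    and sums: "\<And>z. z \<in> ball 0 1 \<Longrightarrow> (\<lambda>n. of_real (a n) * z ^ e n) sums F z"
    and lim: "\<And>z. z \<in> D \<Longrightarrow> norm z = 1 \<and> ((\<lambda>t. F (of_real t * z)) \<longlongrightarrow> F z) (at_left 1)"
    and "1 \<in> D"
  shows "summable a" and "\<And>z. z \<in> D \<Longrightarrow> (\<lambda>n. of_real (a n) * z ^ e n) sums F z"
proof -
  have ev: "eventually (\<lambda>t::real. 0 < t \<and> t < 1) (at_left 1)"
    by (auto simp: eventually_at_left_field intro: exI[of _ 0])
  \<comment> \<open>For \<open>0 < t < 1\<close> a partial sum is at most the full sum
    \<open>Re (F t)\<close>; then \<open>t\<close> tends to 1 with \<open>N\<close> fixed.\<close>
  have "sum a {..<N} \<le> Re (F 1)" for N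
  proof (rule tendsto_le)
    show "((\<lambda>t. Re (F (of_real t * 1))) \<longlongrightarrow> Re (F 1)) (at_left 1)"
      using lim[OF \<open>1 \<in> D\<close>] by (intro tendsto_intros) auto
    have "((\<lambda>t::real. \<Sum>n<N. a n * t ^ e n) \<longlongrightarrow> (\<Sum>n<N. a n * 1 ^ e n)) (at_left 1)"
      by (intro tendsto_intros)
    then show "((\<lambda>t::real. \<Sum>n<N. a n * t ^ e n) \<longlongrightarrow> sum a {..<N}) (at_left 1)"
      by simp
    show "eventually (\<lambda>t. (\<Sum>n<N. a n * t ^ e n) \<le> Re (F (of_real t * 1))) (at_left 1)"
      using ev
    proof eventually_elim
      case (elim t)
      then have "(\<lambda>n. Re (of_real (a n) * of_real t ^ e n)) sums Re (F (of_real t))"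
        by (intro sums_Re sums) auto
      then have "(\<lambda>n. a n * t ^ e n) sums Re (F (of_real t))"
        by (simp flip: of_real_power)
      then have "(\<Sum>n<N. a n * t ^ e n) \<le> Re (F (of_real t))"
        using sum_le_suminf[of "\<lambda>n. a n * t ^ e n" "{..<N}"] elim nonneg by (simp add: sums_iff)
      then show ?case by simp
    qed
  qed simp
  then show summable: "summable a"
    using nonneg by (intro summableI_nonneg_bounded) auto

  fix z assume z: "z \<in> D"
  define G where "G = (\<lambda>z. \<Sum>n. of_real (a n) * z ^ e n :: complex)"
  have bound: "norm (of_real (a n) * w ^ e n) \<le> a n" if "w \<in> cball 0 1" for w :: complex and n
    using that nonneg[of n] by (auto simp: norm_mult norm_power intro!: mult_left_le power_le_one)
  \<comment> \<open>The coefficients themselves are a summable majorant on the closed disc.\<close>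
  have "uniform_limit (cball 0 1) (\<lambda>n w. \<Sum>i<n. of_real (a i) * w ^ e i) G sequentially"
    unfolding G_def by (rule Weierstrass_m_test[OF bound summable])
  then have "continuous_on (cball 0 1) G"
    by (rule uniform_limit_theorem[rotated]) (auto intro!: always_eventually continuous_intros)
  then have "continuous_on {0..1} (\<lambda>t::real. G (of_real t * z))"
    by (rule continuous_on_compose2) (use lim[OF z] in \<open>auto intro!: continuous_intros simp: norm_mult\<close>)
  then have "((\<lambda>t::real. G (of_real t * z)) \<longlongrightarrow> G z) (at_left 1)"
    by (auto simp: continuous_on_Icc_at_leftD dest!: continuous_on_Icc_at_leftD)
  moreover have "eventually (\<lambda>t::real. G (of_real t * z) = F (of_real t * z)) (at_left 1)"
    using ev
  proof eventually_elim
    case (elim t)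
    then have "of_real t * z \<in> ball 0 1"
      using lim[OF z] by (auto simp: norm_mult)
    from sums[OF this] show ?case
      unfolding G_def by (simp add: sums_iff)
  qed
  ultimately have "((\<lambda>t. F (of_real t * z)) \<longlongrightarrow> G z) (at_left 1)"
    by (rule Lim_transform_eventually)
  then have "G z = F z"
    using lim[OF z] by (intro tendsto_unique[of "at_left (1::real)"]) auto
  moreover have "summable (\<lambda>n. of_real (a n) * z ^ e n)"
    by (rule summable_comparison_test'[OF summable bound]) (use lim[OF z] in auto)
  ultimately show "(\<lambda>n. of_real (a n) * z ^ e n) sums F z"
    unfolding G_def by (simp add: sums_iff)
qed

text \<open>At the branch point 1 the radius is real, and continuity of the real
  \<open>arcsin\<close> on \<open>{0..1}\<close> suffices. The remaining points are not real, so
  \<open>Arcsin\<close> is continuous there.\<close>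

lemma tendsto_Arcsin_radial:
  assumes "norm z = 1" and "z \<noteq> -1"
  shows "((\<lambda>t. Arcsin (of_real t * z)) \<longlongrightarrow> Arcsin z) (at_left 1)"
proof (cases "z = 1")
  case True
  have "continuous_on {0..1} arcsin"
    by (rule continuous_on_subset[OF continuous_on_arcsin']) auto
  then have "(arcsin \<longlongrightarrow> arcsin 1) (at_left 1)"
    by (rule continuous_on_Icc_at_leftD) simp
  then have "((\<lambda>t. complex_of_real (arcsin t)) \<longlongrightarrow> of_real (arcsin 1)) (at_left 1)"
    by (rule tendsto_of_real)
  moreover have "eventually (\<lambda>t::real. 0 < t \<and> t < 1) (at_left 1)"
    by (auto simp: eventually_at_left_field intro: exI[of _ 0])
  then have "eventually (\<lambda>t. complex_of_real (arcsin t) = Arcsin (of_real t * z)) (at_left 1)"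
    by eventually_elim (use True in \<open>simp add: of_real_arcsin\<close>)
  ultimately show ?thesis
    using of_real_arcsin[of 1] True by (auto intro: Lim_transform_eventually)
next
  case False
  have "isCont Arcsin z"
  proof (rule isCont_Arcsin)
    assume "Im z = 0"
    then have "\<bar>Re z\<bar> = 1"
      using assms(1) by (simp add: cmod_def)
    then have "z = 1 \<or> z = -1"
      using \<open>Im z = 0\<close> by (auto simp: complex_eq_iff abs_if split: if_splits)
    with False assms(2) show "\<bar>Re z\<bar> < 1" by simp
  qed
  moreover have "((\<lambda>t. of_real t * z) \<longlongrightarrow> of_real 1 * z) (at_left 1)"
    by (intro tendsto_intros)
  ultimately show ?thesis
    by (auto intro: isCont_tendsto_compose)
qed

section \<open>Extraction of a residue class by roots of unity\<close>

text \<open>This is a geometric sum with ratio \<open>x = \<omega> ^ n / \<omega> ^ r\<close>, where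
  \<open>x ^ q = 1\<close>, and \<open>x = 1\<close> exactly when \<open>n\<close> and
  \<open>r\<close> are congruent.\<close>

lemma sum_roots_of_unity_powers:
  fixes q n r :: nat
  assumes "q \<ge> 1" and \<omega>: "\<omega> = exp (2 * of_real pi * \<i> / of_nat q)"
  shows "(\<Sum>l<q. \<omega> powi (- int (r * l)) * (\<omega> ^ l) ^ n) = (if [n = r] (mod q) then of_nat q else 0)"
proof -
  define x where "x = \<omega> ^ n / \<omega> ^ r"
  have nz: "\<omega> \<noteq> 0" by (simp add: \<omega>)
  have pow: "\<omega> ^ j = exp (2 * of_real pi * \<i> * of_nat j / of_nat q)" for j
    unfolding \<omega> by (simp add: exp_of_nat_mult[symmetric] mult_ac)
  have "\<omega> ^ q = 1"
    unfolding \<omega> using complex_root_unity[of q 1] assms(1) by simp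
  then have "x ^ q = 1"
    by (simp add: x_def power_divide nz power_mult[symmetric] mult.commute[of _ q]) (simp add: power_mult nz)
  have x1: "x = 1 \<longleftrightarrow> [n = r] (mod q)"
    using complex_root_unity_eq[OF assms(1), of n r] nz unfolding x_def pow[symmetric] cong_def
    by (simp add: divide_eq_1_iff)
  have "\<omega> powi (- int (r * l)) * (\<omega> ^ l) ^ n = x ^ l" for l
    by (simp add: x_def power_int_minus power_divide power_mult[symmetric] mult.commute field_simps del: of_nat_mult)
  then have "(\<Sum>l<q. \<omega> powi (- int (r * l)) * (\<omega> ^ l) ^ n) = (\<Sum>l<q. x ^ l)"
    by simp
  also have "\<dots> = (if [n = r] (mod q) then of_nat q else 0)"
    using x1 \<open>x ^ q = 1\<close> by (auto simp: geometric_sum)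
  finally show ?thesis .
qed

lemma has_sum_residue_class:
  fixes a :: "nat \<Rightarrow> real" and S :: "nat \<Rightarrow> complex"
  assumes q: "q \<ge> 1" and \<omega>: "\<omega> = exp (2 * of_real pi * \<i> / of_nat q)"
    and nonneg: "\<And>n. a n \<ge> 0" and summable: "summable a"
    and sums: "\<And>l. l < q \<Longrightarrow> (\<lambda>n. of_real (a n) * (\<omega> ^ l) ^ n) sums S l"
  shows "((\<lambda>n. of_real (a n)) has_sum (1 / of_nat q * (\<Sum>l<q. \<omega> powi (- int (r * l)) * S l)))
           {n. [n = r] (mod q)}"
proof -
  define b where "b = (\<lambda>n. if [n = r] (mod q) then complex_of_real (a n) else 0)"
  have "(\<lambda>n. 1 / of_nat q * (\<Sum>l<q. \<omega> powi (- int (r * l)) * (of_real (a n) * (\<omega> ^ l) ^ n)))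
          sums (1 / of_nat q * (\<Sum>l<q. \<omega> powi (- int (r * l)) * S l))"
    by (intro sums_mult sums_sum sums) auto
  moreover have "1 / of_nat q * (\<Sum>l<q. \<omega> powi (- int (r * l)) * (of_real (a n) * (\<omega> ^ l) ^ n)) = b n" for n
  proof -
    have "(\<Sum>l<q. \<omega> powi (- int (r * l)) * (of_real (a n) * (\<omega> ^ l) ^ n)) =
          of_real (a n) * (\<Sum>l<q. \<omega> powi (- int (r * l)) * (\<omega> ^ l) ^ n)"
      by (simp add: sum_distrib_left mult_ac)
    then show ?thesis
      using q unfolding sum_roots_of_unity_powers[OF q \<omega>] b_def by simp
  qed
  ultimately have "b sums (1 / of_nat q * (\<Sum>l<q. \<omega> powi (- int (r * l)) * S l))"
    by simp
  \<comment> \<open>Absolute summability turns the ordered \<open>sums\<close> into the unordered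
    \<open>has_sum\<close>.\<close>
  moreover have "summable (\<lambda>n. norm (b n))"
    by (rule summable_comparison_test'[OF summable, of 0]) (auto simp: b_def nonneg)
  ultimately have "(b has_sum (1 / of_nat q * (\<Sum>l<q. \<omega> powi (- int (r * l)) * S l))) UNIV"
    by (intro norm_summable_imp_has_sum)
  then show ?thesis
    by (subst has_sum_cong_neutral[where T = UNIV and g = b]) (auto simp: b_def)
qed

section \<open>Evaluation at the square roots of the roots of unity\<close>

theorem theorem5p1:
  fixes q r :: nat and \<omega> :: complex and \<eta> :: "nat \<Rightarrow> complex"
  assumes "q \<ge> 1" and "r < q"
    and "\<omega> = exp (2 * of_real pi * \<i> / of_nat q)"
    and "\<And>l. l < q \<Longrightarrow> \<eta> l = exp (\<i> / 2 * of_real (Arg (\<omega> ^ l)))"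
  shows "(\<forall>m::nat.
      ((\<lambda>n. complex_of_real (real ((2 * n) choose n) / (4 ^ n * (2 * real n + 1)) * t_sum2 n m))
        has_sum
        (1 / of_nat q * (\<Sum>l<q. \<omega> powi (- int (r * l)) *
            (Arcsin (\<eta> l) ^ (2 * m + 1) / (fact (2 * m + 1) * \<eta> l)))))
      {n. [n = r] (mod q)}) \<and>
    (\<forall>m::nat. m \<ge> 1 \<longrightarrow>
      ((\<lambda>n. complex_of_real (4 ^ n / ((real n)\<^sup>2 * real ((2 * n) choose n)) * zeta_sum2 (n - 1) (m - 1)))
        has_sum
        (1 / of_nat q * (\<Sum>l<q. \<omega> powi (- int (r * l)) *
            (2 ^ (2 * m) * Arcsin (\<eta> l) ^ (2 * m) / fact (2 * m)))))
      {n. n \<ge> 1 \<and> [n = r] (mod q)})"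
proof -
  define D where "D = {z::complex. norm z = 1 \<and> z \<noteq> -1}"
  have one_D: "1 \<in> D" by (auto simp: D_def complex_eq_iff)
  have lim: "norm z = 1 \<and> ((\<lambda>t. c * arcsin_pow k (of_real t * z)) \<longlongrightarrow> c * arcsin_pow k z) (at_left 1)"
    if "z \<in> D" for z c k
    using that unfolding arcsin_pow_def D_def by (auto intro!: tendsto_intros tendsto_Arcsin_radial)
  have \<eta>_D: "\<eta> l \<in> D" and \<eta>_sq: "\<eta> l ^ 2 = \<omega> ^ l" if "l < q" for l
  proof -
    have "\<omega> ^ l \<noteq> 0" "norm (\<omega> ^ l) = 1"
      by (simp_all add: assms(3) norm_power)
    then have "\<omega> ^ l = exp (\<i> * of_real (Arg (\<omega> ^ l)))"
      using Arg_eq[of "\<omega> ^ l"] by simp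
    then show "\<eta> l ^ 2 = \<omega> ^ l"
      by (simp add: assms(4)[OF that] flip: exp_double)
    have \<eta>: "\<eta> l = cis (Arg (\<omega> ^ l) / 2)"
      by (simp add: assms(4)[OF that] cis_conv_exp)
    \<comment> \<open>Half of a principal argument lies in the interval from \<open>-pi/2\<close> to
      \<open>pi/2\<close>, which keeps \<open>\<eta> l\<close> in the right half-plane and away from
      -1.\<close>
    have "cos (Arg (\<omega> ^ l) / 2) \<ge> 0"
      using Arg_bounded[of "\<omega> ^ l"] by (intro cos_ge_zero) auto
    then have "\<eta> l \<noteq> -1"
      unfolding \<eta> by (auto simp: complex_eq_iff)
    then show "\<eta> l \<in> D"
      by (auto simp: D_def \<eta>)
  qed
  show ?thesis
  proof (intro conjI allI impI)
    fix m :: nat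
    let ?a = "\<lambda>n. real ((2 * n) choose n) / (4 ^ n * (2 * real n + 1)) * t_sum2 n m"
    \<comment> \<open>The factor 1 fits the shape of \<open>lim\<close>, whose constant
      \<open>c\<close> is \<open>2 ^ (2 * m)\<close> in the even case.\<close>
    let ?F = "\<lambda>z. 1 * arcsin_pow (2 * m + 1) z"
    have nonneg: "?a n \<ge> 0" for n
      by (simp add: t_sum2_nonneg)
    have sums: "(\<lambda>n. of_real (?a n) * z ^ (2 * n + 1)) sums ?F z" if "z \<in> ball 0 1" for z
      using arcsin_pow_odd_sums[OF that, of m] by (simp only: mult_1_left)
    note Abel = Abel_nonneg_boundary[of ?a "\<lambda>n. 2 * n + 1" ?F, OF nonneg sums lim one_D]
    show "((\<lambda>n. of_real (?a n)) has_sum (1 / of_nat q * (\<Sum>l<q. \<omega> powi (- int (r * l)) *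
            (Arcsin (\<eta> l) ^ (2 * m + 1) / (fact (2 * m + 1) * \<eta> l))))) {n. [n = r] (mod q)}"
    proof (rule has_sum_residue_class[OF assms(1,3) nonneg])
      show "summable ?a"
        by (rule Abel(1))
      fix l assume l: "l < q"
      have nz: "\<eta> l \<noteq> 0"
        using assms(4)[OF l] by simp
      \<comment> \<open>Dividing by \<open>\<eta> l\<close> leaves even powers, which are powers of
        \<open>\<omega> ^ l\<close>; this is the source of \<open>\<eta> l\<close> in the
        denominator.\<close>
      have "(\<lambda>n. of_real (?a n) * \<eta> l ^ (2 * n + 1) / \<eta> l) sums (?F (\<eta> l) / \<eta> l)"
        by (intro sums_divide Abel(2) \<eta>_D l)
      moreover have "of_real (?a n) * \<eta> l ^ (2 * n + 1) / \<eta> l = of_real (?a n) * (\<omega> ^ l) ^ n" for n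
        using nz by (simp add: power_mult \<eta>_sq[OF l])
      ultimately show "(\<lambda>n. of_real (?a n) * (\<omega> ^ l) ^ n) sums
          (Arcsin (\<eta> l) ^ (2 * m + 1) / (fact (2 * m + 1) * \<eta> l))"
        by (simp only: arcsin_pow_def mult_1_left divide_divide_eq_left)
    qed
  next
    fix m :: nat assume m: "m \<ge> 1"
    let ?a = "\<lambda>n. 4 ^ n / ((real n)\<^sup>2 * real ((2 * n) choose n)) * zeta_sum2 (n - 1) (m - 1)"
    let ?F = "\<lambda>z. 2 ^ (2 * m) * arcsin_pow (2 * m) z"
    let ?S = "1 / of_nat q * (\<Sum>l<q. \<omega> powi (- int (r * l)) *
            (2 ^ (2 * m) * Arcsin (\<eta> l) ^ (2 * m) / fact (2 * m)))"
    have nonneg: "?a n \<ge> 0" for n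
      by (simp add: zeta_sum2_nonneg)
    have sums: "(\<lambda>n. of_real (?a n) * z ^ (2 * n)) sums ?F z" if "z \<in> ball 0 1" for z
      using arcsin_pow_even_sums[OF that m] .
    note Abel = Abel_nonneg_boundary[of ?a "\<lambda>n. 2 * n" ?F, OF nonneg sums lim one_D]
    have "((\<lambda>n. of_real (?a n)) has_sum ?S) {n. [n = r] (mod q)}"
    proof (rule has_sum_residue_class[OF assms(1,3) nonneg])
      show "summable ?a"
        by (rule Abel(1))
      fix l assume l: "l < q"
      have "(\<lambda>n. of_real (?a n) * \<eta> l ^ (2 * n)) sums ?F (\<eta> l)"
        by (intro Abel(2) \<eta>_D l)
      then show "(\<lambda>n. of_real (?a n) * (\<omega> ^ l) ^ n) sums
          (2 ^ (2 * m) * Arcsin (\<eta> l) ^ (2 * m) / fact (2 * m))"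
        by (simp only: power_mult \<eta>_sq[OF l] arcsin_pow_def times_divide_eq_right)
    qed
    \<comment> \<open>The summand at \<open>n = 0\<close> is \<open>0\<close> because division by zero yields zero.\<close>
    then show "((\<lambda>n. of_real (?a n)) has_sum ?S) {n. n \<ge> 1 \<and> [n = r] (mod q)}"
      by (subst has_sum_cong_neutral[where T = "{n. [n = r] (mod q)}" and g = "\<lambda>n. of_real (?a n)"]) auto
  qed
qed

end
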